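(* Let $(\mathbb{X},\circledast)$ be a $\perp$-itegory, and let $f:X\to X$, $g:X\to A$ and $g':X\to A$ be pairwise $\perp$-disjoint maps. Then: (i) $f\circledast g=(f\circledast\overline{g})g$; (ii) $0\circledast g=g$; (iii) $f\circledast0=0$; (iv) if $f\perp g\sqcup g'$, then $f\circledast g\perp f\circledast g'$ and $f\circledast(g\sqcup g')=(f\circledast g)\sqcup(f\circledast g')$; (v) if $f$ is total, then $f\circledast g=0$; (vi) if $g$ is total, then $f\circledast g=g$.
   Context: Composition is diagrammatic: $fg$ means first $f$, then $g$. A restriction category is a category with an operator sending each $f:A\to B$ to $\overline{f}:A\to A$ such that $\overline{f}f=f$; $\overline{f}\,\overline{g}=\overline{g}\,\overline{f}$ and $\overline{\overline{g}f}=\overline{g}\,\overline{f}$ for $f:A\to B$, $g:A\to C$; and $f\overline{g}=\overline{fg}f$ for $f:A\to B$, $g:B\to C$. For parallel $f,g$: $f\le g$ iff $\overline{f}g=f$ (a partial order). A map $f:A\to B$ is total if $\overline{f}=1_A$. Restriction zeroes: maps $0:A\to B$ with $f0=0=0f$ and $\overline{0}=0$. An interference relation $\perp$ on a restriction category with restriction zeroes is a family of relations between maps with the same domain such that: $1_A\perp 0$; $f\perp g\Rightarrow g\perp f$; $f\perp f\Rightarrow f=0$; $f'\perp g'$, $f\le f'$, $g\le g'$ imply $f\perp g$; $f\perp g\Rightarrow hfk\perp hgk'$ for all composable $h,k,k'$; $f\perp g\Rightarrow\overline{f}\perp\overline{g}$. A $\perp$-restriction category is a restriction category with restriction zeroes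 and a chosen interference relation $\perp$. It has all binary $\perp$-joins if any parallel $f\perp g:A\to B$ have a least upper bound $f\sqcup g$ for $\le$ and $h(f\sqcup g)=hf\sqcup hg$ for all $h:A'\to A$. A Kleene wand $\circledast$ on a $\perp$-restriction category with all binary $\perp$-joins assigns to each $f:X\to X$, $g:X\to A$ with $f\perp g$ a map $f\circledast g:X\to A$ such that: (1) if $f \perp g$, then $g\sqcup f(f\circledast g)=f\circledast g$; (2) $(f\circledast g)h=f\circledast gh$ for $f\perp g$, $h:A\to B$; (3) for $f:X\to Y$, $g:X\to A$, $k:Y\to X$ with $f\perp g$: $kf\circledast kg=k(fk\circledast g)$; (4) for $f,f':X\to X$, $g:X\to A$ with $f\perp f'$ and $f\sqcup f'\perp g$: $(f\circledast f')\perp(f\circledast g)$ and $(f\sqcup f')\circledast g=(f\circledast f')\circledast(f\circledast g)$. A $\perp$-itegory is a $\perp$-restriction category with all binary $\perp$-joins and a Kleene wand. *)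

theory Defs
  imports Main
begin

text \<open>
  Categories are small, with a set of objects and a set of arrows carved out of two types.
  Composition is diagrammatic: \<open>f \<cdot> g\<close> is first \<open>f\<close>, then \<open>g\<close>.  All operations are total
  HOL functions; their values are only constrained on the arguments for which they make sense.
  \<open>f \<bottom> g\<close> is interference (disjointness) and \<open>f \<star> g\<close> is the Kleene wand.
\<close>

record ('o, 'm) category =
  Ob :: "'o set"
  Arr :: "'m set"
  Dom :: "'m \<Rightarrow> 'o"
  Cod :: "'m \<Rightarrow> 'o"
  Id :: "'o \<Rightarrow> 'm"
  Comp :: "'m \<Rightarrow> 'm \<Rightarrow> 'm" (infixl "\<cdot>\<index>" 70)

record ('o, 'm) restriction_category = "('o, 'm) category" +
  restr :: "'m \<Rightarrow> 'm"

record ('o, 'm) zero_restriction_category = "('o, 'm) restriction_category" +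
  Zero :: "'o \<Rightarrow> 'o \<Rightarrow> 'm"

record ('o, 'm) perp_restriction_category = "('o, 'm) zero_restriction_category" +
  perp :: "'m \<Rightarrow> 'm \<Rightarrow> bool" (infix "\<bottom>\<index>" 50)

record ('o, 'm) perp_itegory = "('o, 'm) perp_restriction_category" +
  wand :: "'m \<Rightarrow> 'm \<Rightarrow> 'm" (infixl "\<star>\<index>" 68)

definition hom :: "('o, 'm, 'z) category_scheme \<Rightarrow> 'o \<Rightarrow> 'o \<Rightarrow> 'm set" where
  "hom C A B = {f \<in> Arr C. Dom C f = A \<and> Cod C f = B}"

locale category =
  fixes C :: "('o, 'm, 'z) category_scheme" (structure)
  assumes Dom_in_Ob: "f \<in> Arr C \<Longrightarrow> Dom C f \<in> Ob C"
    and Cod_in_Ob: "f \<in> Arr C \<Longrightarrow> Cod C f \<in> Ob C"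
    and Id_in_hom: "A \<in> Ob C \<Longrightarrow> Id C A \<in> hom C A A"
    and Comp_in_hom: "f \<in> hom C A B \<Longrightarrow> g \<in> hom C B D \<Longrightarrow> f \<cdot> g \<in> hom C A D"
    and Id_Comp: "f \<in> hom C A B \<Longrightarrow> Id C A \<cdot> f = f"
    and Comp_Id: "f \<in> hom C A B \<Longrightarrow> f \<cdot> Id C B = f"
    and Comp_assoc: "f \<in> hom C A B \<Longrightarrow> g \<in> hom C B D \<Longrightarrow> h \<in> hom C D E \<Longrightarrow>
      (f \<cdot> g) \<cdot> h = f \<cdot> (g \<cdot> h)"

locale restriction_category = category C
  for C :: "('o, 'm, 'z) restriction_category_scheme" (structure) +
  assumes restr_in_hom: "f \<in> hom C A B \<Longrightarrow> restr C f \<in> hom C A A"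
    and restr_Comp_self: "f \<in> hom C A B \<Longrightarrow> restr C f \<cdot> f = f"
    and restr_commute: "f \<in> hom C A B \<Longrightarrow> g \<in> hom C A D \<Longrightarrow>
      restr C f \<cdot> restr C g = restr C g \<cdot> restr C f"
    and restr_restr_Comp: "f \<in> hom C A B \<Longrightarrow> g \<in> hom C A D \<Longrightarrow>
      restr C (restr C g \<cdot> f) = restr C g \<cdot> restr C f"
    and Comp_restr: "f \<in> hom C A B \<Longrightarrow> g \<in> hom C B D \<Longrightarrow>
      f \<cdot> restr C g = restr C (f \<cdot> g) \<cdot> f"

definition le :: "('o, 'm, 'z) restriction_category_scheme \<Rightarrow> 'm \<Rightarrow> 'm \<Rightarrow> bool"
    (infix "\<sqsubseteq>\<index>" 50) where
  "f \<sqsubseteq>\<^bsub>C\<^esub> g \<longleftrightarrow> (\<exists>A B. f \<in> hom C A B \<and> g \<in> hom C A B) \<and> restr C f \<cdot>\<^bsub>C\<^esub> g = f"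

definition total_map :: "('o, 'm, 'z) restriction_category_scheme \<Rightarrow> 'm \<Rightarrow> bool" where
  "total_map C f \<longleftrightarrow> f \<in> Arr C \<and> restr C f = Id C (Dom C f)"

definition is_join :: "('o, 'm, 'z) restriction_category_scheme \<Rightarrow> 'm \<Rightarrow> 'm \<Rightarrow> 'm \<Rightarrow> bool" where
  "is_join C f g j \<longleftrightarrow> f \<sqsubseteq>\<^bsub>C\<^esub> j \<and> g \<sqsubseteq>\<^bsub>C\<^esub> j \<and>
    (\<forall>k. f \<sqsubseteq>\<^bsub>C\<^esub> k \<and> g \<sqsubseteq>\<^bsub>C\<^esub> k \<longrightarrow> j \<sqsubseteq>\<^bsub>C\<^esub> k)"

definition join :: "('o, 'm, 'z) restriction_category_scheme \<Rightarrow> 'm \<Rightarrow> 'm \<Rightarrow> 'm"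
    (infixl "\<squnion>\<index>" 65) where
  "f \<squnion>\<^bsub>C\<^esub> g = (THE j. is_join C f g j)"

locale zero_restriction_category = restriction_category C
  for C :: "('o, 'm, 'z) zero_restriction_category_scheme" (structure) +
  assumes Zero_in_hom: "A \<in> Ob C \<Longrightarrow> B \<in> Ob C \<Longrightarrow> Zero C A B \<in> hom C A B"
    and Comp_Zero: "f \<in> hom C A B \<Longrightarrow> D \<in> Ob C \<Longrightarrow> f \<cdot> Zero C B D = Zero C A D"
    and Zero_Comp: "f \<in> hom C B D \<Longrightarrow> A \<in> Ob C \<Longrightarrow> Zero C A B \<cdot> f = Zero C A D"
    and restr_Zero: "A \<in> Ob C \<Longrightarrow> B \<in> Ob C \<Longrightarrow> restr C (Zero C A B) = Zero C A A"

locale perp_restriction_category = zero_restriction_category C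
  for C :: "('o, 'm, 'z) perp_restriction_category_scheme" (structure) +
  assumes perp_same_Dom: "f \<bottom> g \<Longrightarrow> f \<in> Arr C \<and> g \<in> Arr C \<and> Dom C f = Dom C g"
    and Id_perp_Zero: "A \<in> Ob C \<Longrightarrow> B \<in> Ob C \<Longrightarrow> Id C A \<bottom> Zero C A B"
    and perp_sym: "f \<bottom> g \<Longrightarrow> g \<bottom> f"
    and perp_self: "f \<in> hom C A B \<Longrightarrow> f \<bottom> f \<Longrightarrow> f = Zero C A B"
    and perp_mono: "f' \<bottom> g' \<Longrightarrow> f \<sqsubseteq> f' \<Longrightarrow> g \<sqsubseteq> g' \<Longrightarrow> f \<bottom> g"
    and perp_Comp: "f \<bottom> g \<Longrightarrow> f \<in> hom C A B \<Longrightarrow> g \<in> hom C A D \<Longrightarrow>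
      h \<in> hom C A' A \<Longrightarrow> k \<in> hom C B B' \<Longrightarrow> k' \<in> hom C D D' \<Longrightarrow>
      h \<cdot> f \<cdot> k \<bottom> h \<cdot> g \<cdot> k'"
    and perp_restr: "f \<bottom> g \<Longrightarrow> restr C f \<bottom> restr C g"

locale perp_join_restriction_category = perp_restriction_category C
  for C :: "('o, 'm, 'z) perp_restriction_category_scheme" (structure) +
  assumes join_exists: "f \<in> hom C A B \<Longrightarrow> g \<in> hom C A B \<Longrightarrow> f \<bottom> g \<Longrightarrow> \<exists>j. is_join C f g j"
    and Comp_join: "f \<in> hom C A B \<Longrightarrow> g \<in> hom C A B \<Longrightarrow> f \<bottom> g \<Longrightarrow> h \<in> hom C A' A \<Longrightarrow>
      h \<cdot> (f \<squnion> g) = h \<cdot> f \<squnion> h \<cdot> g"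

locale perp_itegory = perp_join_restriction_category C
  for C :: "('o, 'm, 'z) perp_itegory_scheme" (structure) +
  assumes wand_in_hom: "f \<in> hom C X X \<Longrightarrow> g \<in> hom C X A \<Longrightarrow> f \<bottom> g \<Longrightarrow> f \<star> g \<in> hom C X A"
    and wand_unfold: "f \<in> hom C X X \<Longrightarrow> g \<in> hom C X A \<Longrightarrow> f \<bottom> g \<Longrightarrow>
      g \<squnion> f \<cdot> (f \<star> g) = f \<star> g"
    and wand_Comp: "f \<in> hom C X X \<Longrightarrow> g \<in> hom C X A \<Longrightarrow> f \<bottom> g \<Longrightarrow> h \<in> hom C A B \<Longrightarrow>
      (f \<star> g) \<cdot> h = f \<star> (g \<cdot> h)"
    and wand_slide: "f \<in> hom C X Y \<Longrightarrow> g \<in> hom C X A \<Longrightarrow> k \<in> hom C Y X \<Longrightarrow> f \<bottom> g \<Longrightarrow>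
      (k \<cdot> f) \<star> (k \<cdot> g) = k \<cdot> ((f \<cdot> k) \<star> g)"
    and wand_join_perp: "f \<in> hom C X X \<Longrightarrow> f' \<in> hom C X X \<Longrightarrow> g \<in> hom C X A \<Longrightarrow>
      f \<bottom> f' \<Longrightarrow> (f \<squnion> f') \<bottom> g \<Longrightarrow> (f \<star> f') \<bottom> (f \<star> g)"
    and wand_join: "f \<in> hom C X X \<Longrightarrow> f' \<in> hom C X X \<Longrightarrow> g \<in> hom C X A \<Longrightarrow>
      f \<bottom> f' \<Longrightarrow> (f \<squnion> f') \<bottom> g \<Longrightarrow>
      (f \<squnion> f') \<star> g = (f \<star> f') \<star> (f \<star> g)"

end

theory Submission
  imports Defs
begin

text \<open>
  The one non-routine point is that disjointness is not assumed to be compatible with joins, so the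
  wand of a join cannot be split by the join axioms of the wand.  Instead, put
  \<open>u = f \<star> e\<close> with \<open>e\<close> the restriction of \<open>g \<squnion> g'\<close>.  Since \<open>e\<close> fixes \<open>g\<close>, \<open>g'\<close> and
  \<open>g \<squnion> g'\<close>, the wand of \<open>f\<close> with each of these is composition with \<open>u\<close>, which
  preserves both disjointness and joins.
\<close>

context category
begin

lemma hom_Ob:
  assumes "f \<in> hom C A B"
  shows "A \<in> Ob C" "B \<in> Ob C"
  using assms Dom_in_Ob Cod_in_Ob by (auto simp: hom_def)

lemma hom_unique:
  assumes "f \<in> hom C A B" "f \<in> hom C A' B'"
  shows "A' = A" "B' = B"
  using assms by (auto simp: hom_def)

end

context restriction_category
begin

lemma le_iff:
  assumes "f \<in> hom C A B"
  shows "f \<sqsubseteq> g \<longleftrightarrow> g \<in> hom C A B \<and> restr C f \<cdot> g = f"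
  using assms hom_unique unfolding le_def by metis

lemma le_refl:
  assumes "f \<in> hom C A B"
  shows "f \<sqsubseteq> f"
  using assms by (simp add: le_iff restr_Comp_self)

text \<open>Writing \<open>f\<close> as \<open>restr C f \<cdot> g\<close>, the two restrictions
  commute, and \<open>g\<close> then absorbs \<open>restr C g\<close>. This yields antisymmetry of
  the order and later lets one restriction serve every map below a join.\<close>

lemma le_restr_Comp:
  assumes "f \<in> hom C A B" "f \<sqsubseteq> g"
  shows "restr C g \<cdot> f = f"
proof -
  have g: "g \<in> hom C A B" and fg: "restr C f \<cdot> g = f"
    using assms by (auto simp: le_iff)
  note rf = restr_in_hom[OF assms(1)] and rg = restr_in_hom[OF g]
  have "restr C g \<cdot> f = restr C g \<cdot> (restr C f \<cdot> g)"
    by (simp add: fg)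
  also have "\<dots> = restr C g \<cdot> restr C f \<cdot> g"
    using Comp_assoc[OF rg rf g] by simp
  also have "\<dots> = restr C f \<cdot> restr C g \<cdot> g"
    using restr_commute[OF assms(1) g] by simp
  also have "\<dots> = restr C f \<cdot> (restr C g \<cdot> g)"
    using Comp_assoc[OF rf rg g] .
  also have "\<dots> = f"
    using restr_Comp_self[OF g] fg by simp
  finally show ?thesis .
qed

lemma le_antisym:
  assumes "f \<sqsubseteq> g" "g \<sqsubseteq> f"
  shows "f = g"
proof -
  obtain A B where f: "f \<in> hom C A B" and g: "g \<in> hom C A B"
    using assms(1) unfolding le_def by blast
  have "f = restr C g \<cdot> f"
    using le_restr_Comp[OF f assms(1)] by simp
  also have "\<dots> = g"
    using assms(2) g by (simp add: le_iff)
  finally show ?thesis .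
qed

text \<open>Antisymmetry makes least upper bounds unique, so the definite description in
  \<open>join\<close> denotes any one that is exhibited.\<close>

lemma join_eqI:
  assumes "is_join C f g j"
  shows "f \<squnion> g = j"
  unfolding join_def using assms
  by (rule the_equality) (use assms le_antisym in \<open>auto simp: is_join_def\<close>)

end

context zero_restriction_category
begin

lemma join_Zero:
  assumes f: "f \<in> hom C A B"
  shows "f \<squnion> Zero C A B = f"
proof (rule join_eqI)
  note Ob = hom_Ob[OF f]
  have "Zero C A B \<sqsubseteq> f"
    using Ob f by (simp add: le_iff[OF Zero_in_hom] restr_Zero Zero_Comp)
  then show "is_join C f (Zero C A B) f"
    using le_refl[OF f] by (simp add: is_join_def)
qed

lemma restr_eq_ZeroD:
  assumes f: "f \<in> hom C A B" and "restr C f = Zero C A A"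
  shows "f = Zero C A B"
  using restr_Comp_self[OF f] Zero_Comp[OF f hom_Ob(1)[OF f]] assms(2) by simp

end

context perp_restriction_category
begin

lemma perp_precomp:
  assumes fg: "f \<bottom> g" and f: "f \<in> hom C A B" and g: "g \<in> hom C A D" and h: "h \<in> hom C A' A"
  shows "h \<cdot> f \<bottom> h \<cdot> g"
  using perp_Comp[OF fg f g h Id_in_hom Id_in_hom] hom_Ob f g
    Comp_Id[OF Comp_in_hom[OF h f]] Comp_Id[OF Comp_in_hom[OF h g]]
  by metis

lemma perp_postcomp:
  assumes fg: "f \<bottom> g" and f: "f \<in> hom C A B" and g: "g \<in> hom C A D"
    and k: "k \<in> hom C B B'" and k': "k' \<in> hom C D D'"
  shows "f \<cdot> k \<bottom> g \<cdot> k'"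
  using perp_Comp[OF fg f g Id_in_hom[OF hom_Ob(1)[OF f]] k k'] Id_Comp[OF f] Id_Comp[OF g]
  by simp

lemma perp_Zero_right:
  assumes f: "f \<in> hom C A B" and D: "D \<in> Ob C"
  shows "f \<bottom> Zero C A D"
proof -
  note A = hom_Ob(1)[OF f]
  note Z = Zero_in_hom[OF A D]
  show ?thesis
    using perp_postcomp[OF Id_perp_Zero[OF A D] Id_in_hom[OF A] Z f Id_in_hom[OF D]]
      Id_Comp[OF f] Comp_Id[OF Z] by simp
qed

text \<open>Restricting both sides by \<open>perp_restr\<close> and then postcomposing the left one
  with \<open>f\<close> restores \<open>f\<close>. This is what allows
  \<open>f \<star> restr C g\<close> to be used as a wand.\<close>

lemma perp_restr_right:
  assumes fg: "f \<bottom> g" and f: "f \<in> hom C A B" and g: "g \<in> hom C A D"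
  shows "f \<bottom> restr C g"
proof -
  note rg = restr_in_hom[OF g]
  show ?thesis
    using perp_postcomp[OF perp_restr[OF fg] restr_in_hom[OF f] rg f Id_in_hom[OF hom_Ob(1)[OF f]]]
      restr_Comp_self[OF f] Comp_Id[OF rg] by simp
qed

text \<open>Totality turns the disjointness of the restrictions into that of an identity and
  \<open>restr C g\<close>. Postcomposing the identity with \<open>restr C g\<close> makes this
  idempotent disjoint from itself, hence zero.\<close>

lemma total_perp_eq_Zero:
  assumes fg: "f \<bottom> g" and f: "f \<in> hom C A B" and g: "g \<in> hom C A D" and "total_map C f"
  shows "g = Zero C A D"
proof -
  note A = hom_Ob(1)[OF f]
  note rg = restr_in_hom[OF g]
  have "restr C f = Id C A"
    using f \<open>total_map C f\<close> by (simp add: total_map_def hom_def)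
  then have "Id C A \<bottom> restr C g"
    using perp_restr[OF fg] by simp
  from perp_postcomp[OF this Id_in_hom[OF A] rg rg Id_in_hom[OF A]]
  have "restr C g \<bottom> restr C g"
    using Id_Comp[OF rg] Comp_Id[OF rg] by simp
  then show ?thesis
    using perp_self[OF rg] restr_eq_ZeroD[OF g] by blast
qed

end

context perp_join_restriction_category
begin

lemma is_join_join:
  assumes "f \<in> hom C A B" "g \<in> hom C A B" "f \<bottom> g"
  shows "is_join C f g (f \<squnion> g)"
  using join_exists[OF assms] join_eqI by blast

lemma join_in_hom:
  assumes "f \<in> hom C A B" "g \<in> hom C A B" "f \<bottom> g"
  shows "f \<squnion> g \<in> hom C A B"
  using is_join_join[OF assms] assms(1) by (simp add: is_join_def le_iff)

end

context perp_itegory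
begin

text \<open>Since \<open>restr C j\<close> fixes \<open>g\<close>, the axiom
  \<open>wand_Comp\<close> moves \<open>g\<close> out of the wand. The remaining left factor depends
  only on \<open>f\<close> and \<open>j\<close>, so all maps below \<open>j\<close> share
  it.\<close>

lemma wand_restr_le:
  assumes f: "f \<in> hom C X X" and j: "j \<in> hom C X A" and fj: "f \<bottom> j"
    and g: "g \<in> hom C X A" and gj: "g \<sqsubseteq> j"
  shows "f \<star> g = (f \<star> restr C j) \<cdot> g"
  using wand_Comp[OF f restr_in_hom[OF j] perp_restr_right[OF fj f j] g] le_restr_Comp[OF g gj]
  by simp

lemma wand_restr:
  assumes "f \<in> hom C X X" "g \<in> hom C X A" "f \<bottom> g"
  shows "f \<star> g = (f \<star> restr C g) \<cdot> g"
  using assms by (intro wand_restr_le le_refl)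

lemma Zero_wand:
  assumes g: "g \<in> hom C X A"
  shows "Zero C X X \<star> g = g"
proof -
  note X = hom_Ob(1)[OF g]
  note Z = Zero_in_hom[OF X X]
  have p: "Zero C X X \<bottom> g"
    using perp_sym[OF perp_Zero_right[OF g X]] .
  \<comment> \<open>Unfolding the wand once gives the join of \<open>g\<close> with a composite
    starting with zero, which \<open>join_Zero\<close> removes.\<close>
  show ?thesis
    using wand_unfold[OF Z g p] Zero_Comp[OF wand_in_hom[OF Z g p] X] join_Zero[OF g] by simp
qed

lemma wand_Zero:
  assumes f: "f \<in> hom C X X" and A: "A \<in> Ob C"
  shows "f \<star> Zero C X A = Zero C X A"
proof -
  note X = hom_Ob(1)[OF f]
  note Z = Zero_in_hom[OF X A] and p = perp_Zero_right[OF f A]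
  \<comment> \<open>The zero map factors as itself followed by the zero endomap of \<open>A\<close>.
    Moved out of the wand, this second factor annihilates whatever precedes it.\<close>
  show ?thesis
    using wand_Comp[OF f Z p Zero_in_hom[OF A A]] Comp_Zero[OF wand_in_hom[OF f Z p] A]
      Comp_Zero[OF Z A] by simp
qed

lemma
  assumes f: "f \<in> hom C X X" and g: "g \<in> hom C X A" and g': "g' \<in> hom C X A"
    and gg': "g \<bottom> g'" and fj: "f \<bottom> (g \<squnion> g')"
  shows wand_perp_wand: "(f \<star> g) \<bottom> (f \<star> g')"
    and wand_join_right: "f \<star> (g \<squnion> g') = (f \<star> g) \<squnion> (f \<star> g')"
proof -
  let ?u = "f \<star> restr C (g \<squnion> g')"
  note j = join_in_hom[OF g g' gg']
  have le: "g \<sqsubseteq> g \<squnion> g'" "g' \<sqsubseteq> g \<squnion> g'"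
    using is_join_join[OF g g' gg'] by (simp_all add: is_join_def)
  have u: "?u \<in> hom C X X"
    using wand_in_hom[OF f restr_in_hom[OF j] perp_restr_right[OF fj f j]] .
  have wg: "f \<star> g = ?u \<cdot> g" "f \<star> g' = ?u \<cdot> g'"
    using wand_restr_le[OF f j fj] g g' le by simp_all
  show "(f \<star> g) \<bottom> (f \<star> g')"
    unfolding wg by (rule perp_precomp[OF gg' g g' u])
  \<comment> \<open>The join is fixed by its own restriction, so its wand has the left factor
    \<open>?u\<close> too, and \<open>Comp_join\<close> distributes \<open>?u\<close>.\<close>
  show "f \<star> (g \<squnion> g') = (f \<star> g) \<squnion> (f \<star> g')"
    using wand_restr[OF f j fj] Comp_join[OF g g' gg' u] wg by simp
qed

end

theorem lemma5p7:
  fixes C :: "('o, 'm, 'z) perp_itegory_scheme" (structure)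
    and X A :: 'o and f g g' :: 'm
  assumes "perp_itegory C"
    and "f \<in> hom C X X" and "g \<in> hom C X A" and "g' \<in> hom C X A"
    and "f \<bottom> g" and "f \<bottom> g'" and "g \<bottom> g'"
  shows "f \<star> g = (f \<star> restr C g) \<cdot> g \<and>
    Zero C X X \<star> g = g \<and>
    f \<star> Zero C X A = Zero C X A \<and>
    (f \<bottom> (g \<squnion> g') \<longrightarrow>
      (f \<star> g) \<bottom> (f \<star> g') \<and> f \<star> (g \<squnion> g') = (f \<star> g) \<squnion> (f \<star> g')) \<and>
    (total_map C f \<longrightarrow> f \<star> g = Zero C X A) \<and>
    (total_map C g \<longrightarrow> f \<star> g = g)"
proof -
  interpret perp_itegory C by fact
  note f = assms(2) and g = assms(3) and g' = assms(4) and fg = assms(5) and gg' = assms(7)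
  note A = hom_Ob(2)[OF g]
  show ?thesis
  proof (intro conjI impI)
    show "f \<star> g = (f \<star> restr C g) \<cdot> g"
      using wand_restr[OF f g fg] .
    show "Zero C X X \<star> g = g"
      using Zero_wand[OF g] .
    show "f \<star> Zero C X A = Zero C X A"
      using wand_Zero[OF f A] .
    show "(f \<star> g) \<bottom> (f \<star> g')" if "f \<bottom> (g \<squnion> g')"
      using wand_perp_wand[OF f g g' gg' that] .
    show "f \<star> (g \<squnion> g') = (f \<star> g) \<squnion> (f \<star> g')" if "f \<bottom> (g \<squnion> g')"
      using wand_join_right[OF f g g' gg' that] .
    \<comment> \<open>A map disjoint from a total one is zero: here \<open>g\<close> vanishes, in
      the last case \<open>f\<close>. Both cases thus reduce to wands with a zero argument.\<close>
    show "f \<star> g = Zero C X A" if "total_map C f"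
      using total_perp_eq_Zero[OF fg f g that] wand_Zero[OF f A] by simp
    show "f \<star> g = g" if "total_map C g"
      using total_perp_eq_Zero[OF perp_sym[OF fg] g f that] Zero_wand[OF g] by simp
  qed
qed

end
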